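(* Consider $n$ agents with positions $x_i(k)\in\mathbb{R}^r$ and velocities $v_i(k)\in\mathbb{R}^r$, $i=1,\dots,n$, evolving for all integers $k\ge 0$ according to $$x_i(k+1)=x_i(k)+v_i(k)T,\qquad v_i(k+1)=u_i(k),$$ $$u_i(k)=\mathrm{S}_{V_i}\big[v_i(k)-p_i(k)v_i(k)T+\pi_i(k)\big],\qquad \pi_i(k)=\sum_{j\in\mathcal{N}_i(k)}a_{ij}(k)\big(x_j(k-\tau_{ij}(k))-x_i(k)\big)T,$$ where the sampling period $T>0$, the constraint sets $V_i$, the operators $\mathrm{S}_{V_i}$, the gains $p_i(k)$, the edge weights $a_{ij}(k)$, the delays $\tau_{ij}(k)$ and the initial data satisfy the standing conditions in the context. Suppose in addition that the following three assumptions hold. 1. For every $i$, $V_i\subseteq\mathbb{R}^r$ is a nonempty bounded closed set with $0\in V_i$, $\max_{x\in V_i}\|\mathrm{S}_{V_i}(x)\|=\bar\rho_i>0$ and $\inf_{x\notin V_i}\|\mathrm{S}_{V_i}(x)\|=\underline{\rho}_i>0$, where $\bar\rho_i,\underline{\rho}_i$ are positive constants. 2. For all $i$ and all $k\ge 0$, $\frac1T>p_i(k+1)\ge b_i(k)>0$; and for every $i$ there is a constant $d_i>0$ such that $p_i^2(k)>4d_i\ge 4\lfloor L(k)\rfloor_{ii}$ for all $k\ge 0$. 3. There exist an infinite sequence of times $k_0,k_1,k_2,\dots$ and a positive integer $\eta$ such that $k_0=0$, $0<k_{m+1}-k_m\le\eta$ for all $m$, and, for every $m$, the union of the graphs $\mathcal{G}(k_m),\mathcal{G}(k_m+1),\dots,\mathcal{G}(k_{m+1}-1)$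 has a directed spanning tree. Then all agents reach a consensus on their positions exponentially fast while their velocities remain in their constraint sets. Specifically: (a) there exist a vector $\bar x\in\mathbb{R}^r$ and constants $C>0$ and $0<\mu\le 1$ such that $\|x_i(k)-\bar x\|\le C(1-\mu)^k$ for all $i$ and all $k\ge 0$; (b) $\lim_{k\to+\infty}v_i(k)=0$ for all $i$, and $v_i(k)\in V_i$ for all $i$ and $k$.
   Context: Graphs. For each integer time $k\ge 0$, $\mathcal{G}(k)$ is a directed graph on the node set $\{1,\dots,n\}$ (one node per agent). An edge $(j,i)$ means that agent $i$ can obtain information from agent $j$. $\mathcal{N}_i(k)$ is the set of $j$ such that $(j,i)$ is an edge of $\mathcal{G}(k)$. The weights satisfy $a_{ij}(k)>0$ if $(j,i)$ is an edge of $\mathcal{G}(k)$ and $a_{ij}(k)=0$ otherwise. There is a constant $\mu_c>0$ such that $a_{ij}(k)\ge\mu_c$ whenever $a_{ij}(k)>0$. $L(k)$ is the Laplacian of $\mathcal{G}(k)$: $\lfloor L(k)\rfloor_{ii}=\sum_{j=1}^n a_{ij}(k)$ and $\lfloor L(k)\rfloor_{ij}=-a_{ij}(k)$ for $i\ne j$, where $\lfloor A\rfloor_{ij}$ denotes the $(i,j)$ entry of $A$. The union of a collection of graphs is the graph whose node and edge sets are the unions of the node and edge sets. A directed graph has a directed spanning tree if there is at least one node having directed paths to all other nodes. Delays. $\tau_{ij}(k)$ are integers with $0\le\tau_{ij}(k)\le M$ for some constant $M>0$. Constraint operator. For a set $V\subseteq\mathbb{R}^r$ (with $0\in V$, bounded,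 closed), $\mathrm{S}_V(0)=0$ and for $x\neq 0$, $$\mathrm{S}_V(x)=\frac{x}{\|x\|}\max_{0\le\beta\le\|x\|}\Big\{\beta\ \Big|\ \frac{\alpha\beta x}{\|x\|}\in V\ \text{ for all } 0\le\alpha\le 1\Big\}.$$ Here $\|\cdot\|$ is the Euclidean norm. No convexity of $V_i$ is assumed. Gains. $p_i(k)>0$ for all $i$ and $k\ge0$. Define, for $k\ge 0$, $$e_i(k)=\frac{\|\mathrm{S}_{V_i}[v_i(k)-p_i(k)v_i(k)T+\pi_i(k)]\|}{\|v_i(k)-p_i(k)v_i(k)T+\pi_i(k)\|},$$ with $e_i(k)=1$ when $v_i(k)-p_i(k)v_i(k)T+\pi_i(k)=0$, and $$b_i(k)=\frac{1-e_i(k)(1-p_i(k)T)}{T}.$$ Initial data. The values $x_i(k),v_i(k)$ for $k\le 0$ are given and satisfy the dynamics $x_i(k+1)=x_i(k)+v_i(k)T$ for $k<0$ and the constraint $v_i(k)\in V_i$; moreover $v_i(0)=\mathrm{S}_{V_i}(v_i(0))$. *)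

theory Defs
  imports "HOL-Analysis.Analysis"
begin

(* GREATEST is the attained maximum; it exists whenever V is closed and contains 0,
   since the set of admissible b is then compact and contains 0. *)
definition constraint_op :: "'a::real_normed_vector set \<Rightarrow> 'a \<Rightarrow> 'a" where
  "constraint_op V x =
     (if x = 0 then 0
      else (GREATEST b. 0 \<le> b \<and> b \<le> norm x \<and>
              (\<forall>\<alpha>. 0 \<le> \<alpha> \<and> \<alpha> \<le> 1 \<longrightarrow> (\<alpha> * b / norm x) *\<^sub>R x \<in> V)) *\<^sub>R (x /\<^sub>R norm x))"

definition constraint_ratio :: "'a::real_normed_vector set \<Rightarrow> 'a \<Rightarrow> real" where
  "constraint_ratio V w = (if w = 0 then 1 else norm (constraint_op V w) / norm w)"

(* A directed graph on the finite node type 'n is given by its edge set;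
   (j, i) is an edge if agent i can obtain information from agent j. *)
definition in_neighbors :: "('n \<times> 'n) set \<Rightarrow> 'n \<Rightarrow> 'n set" where
  "in_neighbors E i = {j. (j, i) \<in> E}"

definition has_spanning_tree :: "('n \<times> 'n) set \<Rightarrow> bool" where
  "has_spanning_tree E \<longleftrightarrow> (\<exists>r. \<forall>i. i \<noteq> r \<longrightarrow> (r, i) \<in> E\<^sup>+)"

(* The diagonal sum ranges over all nodes, so the weight of a self-loop is included. *)
definition laplacian :: "('n::finite \<Rightarrow> 'n \<Rightarrow> real) \<Rightarrow> real ^ 'n ^ 'n" where
  "laplacian A = (\<chi> i j. if i = j then (\<Sum>l\<in>UNIV. A i l) else - A i j)"

end

theory Submission
  imports Defs
begin

text \<open>Consider \<open>y\<^sub>i = x\<^sub>i + (2 / p\<^sub>i) v\<^sub>i\<close> in place of the velocities. The constraint operator only shortens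
  its argument, by the factor \<open>e\<^sub>i\<close>, and \<open>b\<^sub>i\<close> is the gain with \<open>e\<^sub>i (1 - p\<^sub>i T) = 1 - b\<^sub>i T\<close>. So the
  constrained dynamics is linear with time-varying coefficients, and the conditions on the gains make
  \<open>x\<^sub>i(k+1)\<close> and \<open>y\<^sub>i(k+1)\<close> weighted means of \<open>x\<^sub>i(k)\<close>, \<open>y\<^sub>i(k)\<close> and the
  received positions (\<open>feedback_step_as_average\<close>, \<open>position_weight_nonneg\<close>).

  Means keep all positions bounded (\<open>trajectory_bounded\<close>). Hence the arguments of the constraint
  operators are bounded, and since a shortened vector has at least the length \<open>\<rho>_inf\<close>
  (\<open>norm_constraint_op_ge\<close>), the \<open>e\<^sub>i\<close> are bounded away from zero. With them so are the weights of the
  edges; the weights of \<open>y\<^sub>i\<close> are at least \<open>p\<^sub>i(0) T / 2\<close> because the gains do not decrease.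

  Each coordinate is now a scalar averaging process with delays. Let \<open>[l, h]\<close> contain its recent
  history. Some nodes have \<open>y\<^sub>i\<close> in the lower half and the others have it in the upper half. The
  property of staying away from \<open>h\<close> (respectively from \<open>l\<close>) persists, with a margin that loses a
  constant factor in each step, and is passed on along edges. A spanning tree lets the set of nodes
  away from \<open>h\<close> or the set of those away from \<open>l\<close> grow, whatever its root, because the root cannot
  lie outside both. After as many periods as there are nodes one of the sets contains all nodes
  (\<open>one_of_two_spreading_sets_fills\<close>), and the interval has shrunk by a fixed factor
  (\<open>confined_contracts\<close>). Nested intervals give the limit and the rate; the velocities are
  \<open>(p\<^sub>i / 2) (y\<^sub>i - x\<^sub>i)\<close> and tend to zero.\<close>

section \<open>The constraint operator\<close>

lemma constraint_op_radial:
  fixes x :: "'a::real_normed_vector"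
  assumes "closed V" "0 \<in> V" "x \<noteq> 0"
  obtains \<beta> where "constraint_op V x = (\<beta> / norm x) *\<^sub>R x" "0 \<le> \<beta>" "\<beta> \<le> norm x"
    "\<And>\<alpha>. 0 \<le> \<alpha> \<Longrightarrow> \<alpha> \<le> 1 \<Longrightarrow> (\<alpha> * \<beta> / norm x) *\<^sub>R x \<in> V"
    "\<And>b. 0 \<le> b \<Longrightarrow> b \<le> norm x \<Longrightarrow>
       (\<And>\<alpha>. 0 \<le> \<alpha> \<Longrightarrow> \<alpha> \<le> 1 \<Longrightarrow> (\<alpha> * b / norm x) *\<^sub>R x \<in> V) \<Longrightarrow> b \<le> \<beta>"
proof -
  define P where "P b \<longleftrightarrow> 0 \<le> b \<and> b \<le> norm x \<and>
      (\<forall>\<alpha>. 0 \<le> \<alpha> \<and> \<alpha> \<le> 1 \<longrightarrow> (\<alpha> * b / norm x) *\<^sub>R x \<in> V)" for b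
  have "Collect P = {0..norm x} \<inter>
      (\<Inter>\<alpha>\<in>{0..1}. (\<lambda>b. (\<alpha> * b / norm x) *\<^sub>R x) -` V)"
    unfolding P_def by auto
  moreover have "closed ((\<lambda>b. (\<alpha> * b / norm x) *\<^sub>R x) -` V)" for \<alpha>
    by (intro closed_vimage assms(1) continuous_intros) (use assms in auto)
  ultimately have "compact (Collect P)"
    by (auto intro!: compact_Int_closed closed_INT)
  moreover have "P 0"
    unfolding P_def using assms by auto
  ultimately obtain \<beta> where \<beta>: "P \<beta>" "\<And>b. P b \<Longrightarrow> b \<le> \<beta>"
    using compact_attains_sup[of "Collect P"] by auto
  have "Greatest P = \<beta>"
    using \<beta> by (rule Greatest_equality)
  moreover have "constraint_op V x = Greatest P *\<^sub>R (x /\<^sub>R norm x)"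
    using assms(3) unfolding constraint_op_def P_def by simp
  ultimately have "constraint_op V x = (\<beta> / norm x) *\<^sub>R x"
    by (simp add: divide_inverse)
  then show thesis
    using \<beta> that[of \<beta>] unfolding P_def by blast
qed

lemma constraint_op_mem:
  fixes x :: "'a::real_normed_vector"
  assumes "closed V" "0 \<in> V"
  shows "constraint_op V x \<in> V"
proof (cases "x = 0")
  case True
  then show ?thesis using assms by (simp add: constraint_op_def)
next
  case False
  obtain \<beta> where "constraint_op V x = (\<beta> / norm x) *\<^sub>R x"
    and "\<And>\<alpha>. 0 \<le> \<alpha> \<Longrightarrow> \<alpha> \<le> 1 \<Longrightarrow> (\<alpha> * \<beta> / norm x) *\<^sub>R x \<in> V"
    using constraint_op_radial[OF assms False] by metis
  from this(1) this(2)[of 1] show ?thesis by simp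
qed

lemma constraint_op_scales:
  fixes x :: "'a::real_normed_vector"
  assumes "closed V" "0 \<in> V"
  shows "constraint_op V x = constraint_ratio V x *\<^sub>R x"
    and "0 \<le> constraint_ratio V x" and "constraint_ratio V x \<le> 1"
proof -
  have "constraint_op V x = constraint_ratio V x *\<^sub>R x \<and> constraint_ratio V x \<le> 1"
  proof (cases "x = 0")
    case True
    then show ?thesis by (simp add: constraint_op_def constraint_ratio_def)
  next
    case False
    obtain \<beta> where \<beta>: "constraint_op V x = (\<beta> / norm x) *\<^sub>R x" "0 \<le> \<beta>" "\<beta> \<le> norm x"
      using constraint_op_radial[OF assms False] by metis
    then have "constraint_ratio V x = \<beta> / norm x"
      using False by (simp add: constraint_ratio_def)
    then show ?thesis using \<beta> False by simp
  qed
  then show "constraint_op V x = constraint_ratio V x *\<^sub>R x" "constraint_ratio V x \<le> 1"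
    by auto
  show "0 \<le> constraint_ratio V x"
    by (simp add: constraint_ratio_def)
qed

text \<open>A point of \<open>V\<close> can be shortened as well, since \<open>V\<close> need not be star-shaped. But then the
  segment from the origin to \<open>x\<close> contains a point \<open>y\<close> outside \<open>V\<close>, and every length admissible for
  \<open>y\<close> is admissible for \<open>x\<close>. So a bound for the points of \<open>- V\<close> holds for every shortened vector.\<close>

lemma norm_constraint_op_ge:
  fixes x :: "'a::real_normed_vector"
  assumes "closed V" "0 \<in> V" and \<rho>: "\<And>y. y \<notin> V \<Longrightarrow> \<rho> \<le> norm (constraint_op V y)"
    and "constraint_ratio V x < 1"
  shows "\<rho> \<le> norm (constraint_op V x)"
proof -
  have x: "x \<noteq> 0"
    using assms(4) by (auto simp: constraint_ratio_def)
  obtain \<beta> where \<beta>: "constraint_op V x = (\<beta> / norm x) *\<^sub>R x" "0 \<le> \<beta>" "\<beta> \<le> norm x"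
    and max: "\<And>b. 0 \<le> b \<Longrightarrow> b \<le> norm x \<Longrightarrow>
       (\<And>\<alpha>. 0 \<le> \<alpha> \<Longrightarrow> \<alpha> \<le> 1 \<Longrightarrow> (\<alpha> * b / norm x) *\<^sub>R x \<in> V) \<Longrightarrow> b \<le> \<beta>"
    using constraint_op_radial[OF assms(1,2) x] by metis
  have nx: "norm (constraint_op V x) = \<beta>"
    using \<beta> x by simp
  then have "\<beta> < norm x"
    using assms(4) x by (simp add: constraint_ratio_def)
  then obtain \<alpha> where \<alpha>: "0 \<le> \<alpha>" "\<alpha> \<le> 1" "\<alpha> *\<^sub>R x \<notin> V"
    using max[of "norm x"] x by force
  define y where "y = \<alpha> *\<^sub>R x"
  have "\<alpha> \<noteq> 0"
    using \<alpha> assms(2) by auto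
  then have y: "y \<noteq> 0" and "\<alpha> > 0"
    using x \<alpha> by (auto simp: y_def)
  obtain \<gamma> where \<gamma>: "constraint_op V y = (\<gamma> / norm y) *\<^sub>R y" "0 \<le> \<gamma>" "\<gamma> \<le> norm y"
    and mem: "\<And>\<alpha>. 0 \<le> \<alpha> \<Longrightarrow> \<alpha> \<le> 1 \<Longrightarrow> (\<alpha> * \<gamma> / norm y) *\<^sub>R y \<in> V"
    using constraint_op_radial[OF assms(1,2) y] by metis
  have same_ray: "(t / norm y) *\<^sub>R y = (t / norm x) *\<^sub>R x" for t
    using \<open>\<alpha> > 0\<close> x by (simp add: y_def)
  have "norm y \<le> norm x"
    using \<alpha> by (simp add: y_def mult_left_le_one_le)
  then have "\<gamma> \<le> \<beta>"
    using max[of \<gamma>] \<gamma> mem unfolding same_ray by auto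
  moreover have "norm (constraint_op V y) = \<gamma>"
    using \<gamma> y by simp
  ultimately show ?thesis
    using \<rho>[of y] \<alpha> nx by (simp add: y_def)
qed

lemma constraint_ratio_ge:
  fixes x :: "'a::real_normed_vector"
  assumes "closed V" "0 \<in> V" "\<And>y. y \<notin> V \<Longrightarrow> \<rho> \<le> norm (constraint_op V y)"
    and "0 \<le> \<rho>" "norm x \<le> W" "0 < W"
  shows "min 1 (\<rho> / W) \<le> constraint_ratio V x"
proof (cases "constraint_ratio V x < 1")
  case True
  then have "x \<noteq> 0"
    by (auto simp: constraint_ratio_def)
  have "\<rho> / W \<le> norm (constraint_op V x) / norm x"
    using norm_constraint_op_ge[OF assms(1,2,3) True] assms(4-6) \<open>x \<noteq> 0\<close>
    by (intro frac_le) auto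
  then show ?thesis
    using \<open>x \<noteq> 0\<close> by (simp add: constraint_ratio_def)
qed simp


section \<open>Spreading along spanning trees\<close>

lemma trancl_enters_set:
  assumes "(r, i) \<in> E\<^sup>+" "r \<notin> S" "i \<in> S"
  shows "\<exists>j l. (j, l) \<in> E \<and> j \<notin> S \<and> l \<in> S"
  using assms by (induction rule: trancl_induct) auto

lemma has_spanning_tree_mono: "has_spanning_tree E \<Longrightarrow> E \<subseteq> F \<Longrightarrow> has_spanning_tree F"
  unfolding has_spanning_tree_def using trancl_mono by metis

text \<open>The root lies in \<open>A\<close> or in \<open>B\<close>, and a path from it to a node outside that set leaves the set.
  Which of the two sets grows depends on the root, but the root need not stay the same when the
  statement is applied repeatedly.\<close>

lemma spanning_tree_leaves_one_of_two:
  assumes "has_spanning_tree E" "A \<union> B = UNIV" "A \<noteq> UNIV" "B \<noteq> UNIV"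
  shows "\<exists>j i. (j, i) \<in> E \<and> (j \<in> A \<and> i \<notin> A \<or> j \<in> B \<and> i \<notin> B)"
proof -
  obtain r where r: "\<And>i. i \<noteq> r \<Longrightarrow> (r, i) \<in> E\<^sup>+"
    using assms(1) unfolding has_spanning_tree_def by metis
  have *: "\<exists>j i. (j, i) \<in> E \<and> j \<in> S \<and> i \<notin> S" if S: "r \<in> S" "S \<noteq> UNIV" for S
  proof -
    obtain i where "i \<notin> S" using S(2) by blast
    then show ?thesis
      using trancl_enters_set[OF r, of i "- S"] S by auto
  qed
  show ?thesis
    using *[of A] *[of B] assms by blast
qed

text \<open>Until \<open>A\<close> or \<open>B\<close> is full, each stage adds a node to one of them. Their cardinalities add up to
  at least \<open>CARD('n)\<close> at the start, hence to \<open>2 * CARD('n)\<close> after \<open>CARD('n)\<close> such stages.\<close>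

lemma one_of_two_spreading_sets_fills:
  fixes A B :: "nat \<Rightarrow> 'n::finite set"
  assumes cover: "A 0 \<union> B 0 = UNIV"
    and tree: "\<And>m. has_spanning_tree (E m)"
    and mono: "\<And>m. A m \<subseteq> A (Suc m)" "\<And>m. B m \<subseteq> B (Suc m)"
    and spread: "\<And>m i j. (j, i) \<in> E m \<Longrightarrow> j \<in> A m \<Longrightarrow> i \<in> A (Suc m)"
      "\<And>m i j. (j, i) \<in> E m \<Longrightarrow> j \<in> B m \<Longrightarrow> i \<in> B (Suc m)"
  shows "A CARD('n) = UNIV \<or> B CARD('n) = UNIV"
proof -
  have le: "A 0 \<subseteq> A m" "B 0 \<subseteq> B m" for m
    using lift_Suc_mono_le[of A 0 m] lift_Suc_mono_le[of B 0 m] mono by auto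
  have "A m = UNIV \<or> B m = UNIV \<or> CARD('n) + m \<le> card (A m) + card (B m)" for m
  proof (induction m)
    case 0
    then show ?case
      using card_Un_le[of "A 0" "B 0"] cover by simp
  next
    case (Suc m)
    show ?case
    proof (cases "A m = UNIV \<or> B m = UNIV")
      case True
      then show ?thesis using mono[of m] by auto
    next
      case False
      then have ge: "CARD('n) + m \<le> card (A m) + card (B m)"
        using Suc by auto
      have sub: "card (A m) \<le> card (A (Suc m))" "card (B m) \<le> card (B (Suc m))"
        by (simp_all add: card_mono mono)
      have "A m \<union> B m = UNIV"
        using le[of m] cover by auto
      then obtain j i where "(j, i) \<in> E m" "j \<in> A m \<and> i \<notin> A m \<or> j \<in> B m \<and> i \<notin> B m"
        using spanning_tree_leaves_one_of_two[OF tree] False by metis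
      then have "A m \<subset> A (Suc m) \<or> B m \<subset> B (Suc m)"
        using spread mono[of m] by blast
      then have "card (A m) < card (A (Suc m)) \<or> card (B m) < card (B (Suc m))"
        using psubset_card_mono[of "A (Suc m)" "A m"] psubset_card_mono[of "B (Suc m)" "B m"]
        by auto
      then show ?thesis using ge sub by linarith
    qed
  qed
  from this[of "CARD('n)"] show ?thesis
  proof (elim disjE)
    assume "CARD('n) + CARD('n) \<le> card (A CARD('n)) + card (B CARD('n))"
    moreover have "card (A CARD('n)) \<le> CARD('n)" "card (B CARD('n)) \<le> CARD('n)"
      by (auto intro: card_mono)
    ultimately have "card (A CARD('n)) = CARD('n)" by linarith
    then show ?thesis by (simp add: card_eq_UNIV_imp_eq_UNIV)
  qed auto
qed


section \<open>Averaging with delays\<close>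

locale delayed_averaging =
  fixes \<theta> c f :: "nat \<Rightarrow> 'n::finite \<Rightarrow> real"
    and g :: "nat \<Rightarrow> 'n \<Rightarrow> 'n \<Rightarrow> real"
    and \<tau> :: "nat \<Rightarrow> 'n \<Rightarrow> 'n \<Rightarrow> nat"
    and D :: nat
  assumes \<theta>: "0 \<le> \<theta> k i" "\<theta> k i \<le> 1"
    and nonneg_weights: "0 \<le> c k i" "0 \<le> f k i" "0 \<le> g k i j"
    and weights_sum: "c k i + f k i + (\<Sum>j\<in>UNIV. g k i j) = 1"
    and delay_le: "\<tau> k i j \<le> D"
begin

text \<open>Only \<open>X\<close> is received with a delay, so only \<open>X\<close> needs a past and has the integers as its times.\<close>

definition trajectory :: "('n \<Rightarrow> int \<Rightarrow> real) \<Rightarrow> ('n \<Rightarrow> nat \<Rightarrow> real) \<Rightarrow> bool" where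
  "trajectory X Y \<longleftrightarrow> (\<forall>i k.
     X i (int k + 1) = (1 - \<theta> k i) * X i (int k) + \<theta> k i * Y i k \<and>
     Y i (Suc k) = c k i * Y i k + f k i * X i (int k)
       + (\<Sum>j\<in>UNIV. g k i j * X j (int k - int (\<tau> k i j))))"

definition nonneg_at :: "('n \<Rightarrow> int \<Rightarrow> real) \<Rightarrow> ('n \<Rightarrow> nat \<Rightarrow> real) \<Rightarrow> nat \<Rightarrow> bool" where
  "nonneg_at X Y k \<longleftrightarrow>
     (\<forall>i. 0 \<le> Y i k \<and> (\<forall>s. int k - int D \<le> s \<and> s \<le> int k \<longrightarrow> 0 \<le> X i s))"

text \<open>Bounds are treated as nonnegativity of the gaps, which are trajectories again because the
  weights sum to one. This makes upper and lower bounds instances of the same statements.\<close>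

definition confined ::
  "('n \<Rightarrow> int \<Rightarrow> real) \<Rightarrow> ('n \<Rightarrow> nat \<Rightarrow> real) \<Rightarrow> nat \<Rightarrow> real \<Rightarrow> real \<Rightarrow> bool" where
  "confined X Y k l h \<longleftrightarrow>
     nonneg_at (\<lambda>i s. X i s - l) (\<lambda>i s. Y i s - l) k \<and>
     nonneg_at (\<lambda>i s. h - X i s) (\<lambda>i s. h - Y i s) k"

lemma trajectory_affine:
  assumes "trajectory X Y"
  shows "trajectory (\<lambda>i s. r * X i s + q) (\<lambda>i s. r * Y i s + q)"
  unfolding trajectory_def
proof (intro allI conjI)
  fix i k
  have X: "X i (int k + 1) = (1 - \<theta> k i) * X i (int k) + \<theta> k i * Y i k"
    and Y: "Y i (Suc k) = c k i * Y i k + f k i * X i (int k)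
       + (\<Sum>j\<in>UNIV. g k i j * X j (int k - int (\<tau> k i j)))"
    using assms unfolding trajectory_def by auto
  show "r * X i (int k + 1) + q =
      (1 - \<theta> k i) * (r * X i (int k) + q) + \<theta> k i * (r * Y i k + q)"
    unfolding X by (simp add: algebra_simps)
  have "(\<Sum>j\<in>UNIV. g k i j * (r * X j (int k - int (\<tau> k i j)) + q)) =
      r * (\<Sum>j\<in>UNIV. g k i j * X j (int k - int (\<tau> k i j))) + q * (\<Sum>j\<in>UNIV. g k i j)"
    by (simp add: sum_distrib_left sum.distrib algebra_simps)
  also have "(\<Sum>j\<in>UNIV. g k i j) = 1 - c k i - f k i"
    using weights_sum[of k i] by simp
  finally show "r * Y i (Suc k) + q =
      c k i * (r * Y i k + q) + f k i * (r * X i (int k) + q)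
      + (\<Sum>j\<in>UNIV. g k i j * (r * X j (int k - int (\<tau> k i j)) + q))"
    unfolding Y by (simp add: algebra_simps)
qed

lemma trajectory_gaps:
  assumes "trajectory X Y"
  shows "trajectory (\<lambda>i s. X i s - q) (\<lambda>i s. Y i s - q)"
    and "trajectory (\<lambda>i s. q - X i s) (\<lambda>i s. q - Y i s)"
  using trajectory_affine[OF assms, of 1 "- q"] trajectory_affine[OF assms, of "- 1" q] by simp_all

lemma nonneg_at_delayed:
  assumes "nonneg_at X Y k"
  shows "0 \<le> X j (int k - int (\<tau> k i j))" "0 \<le> X i (int k)" "0 \<le> Y i k"
  using assms delay_le[of k i j] unfolding nonneg_at_def by auto

lemma nonneg_at_Suc:
  assumes "trajectory X Y" "nonneg_at X Y k"
  shows "nonneg_at X Y (Suc k)"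
  unfolding nonneg_at_def
proof (intro allI conjI impI)
  fix i
  note nn = nonneg_at_delayed[OF assms(2)] nonneg_weights \<theta>
  show "0 \<le> Y i (Suc k)"
    using assms(1) nn unfolding trajectory_def
    by (auto intro!: add_nonneg_nonneg sum_nonneg mult_nonneg_nonneg)
  fix s assume s: "int (Suc k) - int D \<le> s \<and> s \<le> int (Suc k)"
  show "0 \<le> X i s"
  proof (cases "s = int k + 1")
    case True
    have "0 \<le> (1 - \<theta> k i) * X i (int k) + \<theta> k i * Y i k"
      using nn by (auto intro!: add_nonneg_nonneg mult_nonneg_nonneg)
    then show ?thesis
      using assms(1) True unfolding trajectory_def by simp
  next
    case False
    then show ?thesis
      using s assms(2) unfolding nonneg_at_def by auto
  qed
qed

lemma nonneg_at_mono:
  assumes "trajectory X Y" "nonneg_at X Y k" "k \<le> k'"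
  shows "nonneg_at X Y k'"
  using assms(3) by (induction rule: dec_induct) (auto intro: assms(2) nonneg_at_Suc[OF assms(1)])

lemma confined_mono:
  assumes "trajectory X Y" "confined X Y k l h" "k \<le> k'"
  shows "confined X Y k' l h"
  using assms(2) nonneg_at_mono[OF trajectory_gaps(1)[OF assms(1)] _ assms(3)]
    nonneg_at_mono[OF trajectory_gaps(2)[OF assms(1)] _ assms(3)]
  unfolding confined_def by blast

lemma confinedD:
  assumes "confined X Y k l h"
  shows "l \<le> Y i k" "Y i k \<le> h"
    and "\<And>s. int k - int D \<le> s \<Longrightarrow> s \<le> int k \<Longrightarrow> l \<le> X i s \<and> X i s \<le> h"
  using assms unfolding confined_def nonneg_at_def by auto

lemma confined_initially:
  obtains R where "confined X Y 0 (- R) R"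
proof -
  define F where "F = (\<Union>i. (\<lambda>s. \<bar>X i s\<bar>) ` {- int D..0}) \<union> range (\<lambda>i. \<bar>Y i 0\<bar>)"
  have "finite F" unfolding F_def by auto
  then have le: "y \<le> Max F" if "y \<in> F" for y using that by simp
  have "\<bar>Y i 0\<bar> \<le> Max F" for i
    by (rule le) (simp add: F_def)
  moreover have "\<bar>X i s\<bar> \<le> Max F" if "- int D \<le> s" "s \<le> 0" for i s
  proof (rule le)
    have "\<bar>X i s\<bar> \<in> (\<lambda>s. \<bar>X i s\<bar>) ` {- int D..0}" using that by (intro imageI) simp
    then show "\<bar>X i s\<bar> \<in> F" unfolding F_def by blast
  qed
  ultimately have "confined X Y 0 (- Max F) (Max F)"
    unfolding confined_def nonneg_at_def abs_le_iff by (simp add: neg_le_iff_le) (smt (verit))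
  then show thesis by (rule that)
qed

lemma trajectory_bounded:
  assumes "trajectory X Y"
  obtains R where "\<And>i s. - int D \<le> s \<Longrightarrow> \<bar>X i s\<bar> \<le> R"
proof -
  obtain R where R: "confined X Y 0 (- R) R"
    by (rule confined_initially)
  have "\<bar>X i s\<bar> \<le> R" if s: "- int D \<le> s" for i s
    using confinedD(3)[OF confined_mono[OF assms R, of "nat s"], of s i] s
    by (cases "s \<ge> 0") auto
  then show thesis by (rule that)
qed

end


section \<open>Exponential contraction\<close>

text \<open>The edges of the first \<open>D + 1\<close> steps of a period do not count for its spanning tree: afterwards
  every delayed value belongs to a time later than the beginning of the period, so that it inherits
  the bounds valid there.\<close>

locale delayed_consensus = delayed_averaging \<theta> c f g \<tau> D
  for \<theta> c f :: "nat \<Rightarrow> 'n::finite \<Rightarrow> real" and g \<tau> D +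
  fixes G :: "nat \<Rightarrow> ('n \<times> 'n) set" and \<alpha> :: real and K :: nat
  assumes \<alpha>: "0 < \<alpha>" "\<alpha> \<le> 1"
    and weights_ge: "\<alpha> \<le> \<theta> k i" "\<alpha> \<le> c k i" "(j, i) \<in> G k \<Longrightarrow> \<alpha> \<le> g k i j"
    and tree: "has_spanning_tree (\<Union>s\<in>{k + D + 1..<k + K}. G s)"
begin

lemma Y_persists:
  assumes "trajectory X Y" "nonneg_at X Y k" "\<epsilon> \<le> Y i k" "0 \<le> \<epsilon>"
  shows "\<alpha> ^ d * \<epsilon> \<le> Y i (k + d)"
proof (induction d)
  case (Suc d)
  have nn: "nonneg_at X Y (k + d)"
    using assms nonneg_at_mono by simp
  note nn = nonneg_at_delayed[OF nn] nonneg_weights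
  have "\<alpha> ^ Suc d * \<epsilon> \<le> \<alpha> * Y i (k + d)"
    using Suc \<alpha> by simp
  also have "\<dots> \<le> c (k + d) i * Y i (k + d)"
    using nn weights_ge by (intro mult_right_mono) auto
  also have "\<dots> \<le> Y i (Suc (k + d))"
  proof -
    have "0 \<le> f (k + d) i * X i (int (k + d))
        + (\<Sum>j\<in>UNIV. g (k + d) i j * X j (int (k + d) - int (\<tau> (k + d) i j)))"
      using nn by (intro add_nonneg_nonneg sum_nonneg mult_nonneg_nonneg) auto
    moreover have "Y i (Suc (k + d)) = c (k + d) i * Y i (k + d) + (f (k + d) i * X i (int (k + d))
        + (\<Sum>j\<in>UNIV. g (k + d) i j * X j (int (k + d) - int (\<tau> (k + d) i j))))"
      using assms(1) unfolding trajectory_def add.assoc by blast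
    ultimately show ?thesis by linarith
  qed
  finally show ?case by simp
qed (use assms in simp)

lemma Y_spreads_to_X:
  assumes "trajectory X Y" "nonneg_at X Y k" "\<epsilon> \<le> Y i k" "0 \<le> \<epsilon>" "int k < s"
  shows "\<alpha> ^ nat (s - int k) * \<epsilon> \<le> X i s"
proof -
  define d where "d = nat (s - int k - 1)"
  have s: "s = int (k + d) + 1" and d: "nat (s - int k) = Suc d"
    using assms(5) unfolding d_def by auto
  have nn: "nonneg_at X Y (k + d)"
    using assms nonneg_at_mono by simp
  note nn = nonneg_at_delayed[OF nn] \<theta>[of "k + d" i]
  have "\<alpha> ^ Suc d * \<epsilon> \<le> \<alpha> * Y i (k + d)"
    using Y_persists[OF assms(1-4), of d] \<alpha> by simp
  also have "\<dots> \<le> \<theta> (k + d) i * Y i (k + d)"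
    using nn weights_ge by (intro mult_right_mono) auto
  also have "\<dots> \<le> (1 - \<theta> (k + d) i) * X i (int (k + d)) + \<theta> (k + d) i * Y i (k + d)"
    using nn by simp
  also have "\<dots> = X i s"
    using assms(1) s unfolding trajectory_def by metis
  finally show ?thesis using d by simp
qed

lemma X_spreads_along_edge:
  assumes "trajectory X Y" "nonneg_at X Y k" "(j, i) \<in> G k"
  shows "\<alpha> * X j (int k - int (\<tau> k i j)) \<le> Y i (Suc k)"
proof -
  note nn = nonneg_at_delayed[OF assms(2)] nonneg_weights
  have "\<alpha> * X j (int k - int (\<tau> k i j)) \<le> g k i j * X j (int k - int (\<tau> k i j))"
    using nn weights_ge(3)[OF assms(3)] by (intro mult_right_mono) auto
  also have "\<dots> \<le> (\<Sum>j\<in>UNIV. g k i j * X j (int k - int (\<tau> k i j)))"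
    using nn by (intro member_le_sum) auto
  also have "\<dots> \<le> Y i (Suc k)"
    using assms(1) nn unfolding trajectory_def by simp
  finally show ?thesis .
qed

text \<open>One factor \<open>\<alpha>\<close> for each elapsed step suffices: using an edge costs one factor, as keeping a
  bound for one step does, and the time bridged by the delay costs nothing.\<close>

lemma Y_spreads_along_edge:
  assumes "trajectory X Y" "nonneg_at X Y k" "\<epsilon> \<le> Y j k" "0 \<le> \<epsilon>"
    and "(j, i) \<in> G s" "k + D < s" "s < k'"
  shows "\<alpha> ^ (k' - k) * \<epsilon> \<le> Y i k'"
proof -
  define t where "t = int s - int (\<tau> s i j)"
  have t: "int k < t" "t \<le> int s"
    using delay_le[of s i j] assms(6) unfolding t_def by linarith+
  have nns: "nonneg_at X Y s" "nonneg_at X Y (Suc s)"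
    using assms(1,2,6) nonneg_at_mono by auto
  have "\<alpha> ^ (Suc s - k) * \<epsilon> \<le> \<alpha> ^ Suc (nat (t - int k)) * \<epsilon>"
    using \<alpha> t assms(4) by (intro mult_right_mono power_decreasing) linarith+
  also have "\<dots> \<le> \<alpha> * X j t"
    using Y_spreads_to_X[OF assms(1-4) t(1)] \<alpha> by simp
  also have "\<dots> \<le> Y i (Suc s)"
    using X_spreads_along_edge[OF assms(1) nns(1) assms(5)] unfolding t_def .
  finally have "\<alpha> ^ (k' - Suc s) * (\<alpha> ^ (Suc s - k) * \<epsilon>) \<le> Y i (Suc s + (k' - Suc s))"
    using assms(4) \<alpha> by (intro Y_persists[OF assms(1) nns(2)]) auto
  moreover have "\<alpha> ^ (k' - Suc s) * \<alpha> ^ (Suc s - k) = \<alpha> ^ (k' - k)"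
    using assms(6,7) by (simp flip: power_add)
  ultimately show ?thesis
    using assms(7) by (simp flip: mult.assoc)
qed

text \<open>\<open>CARD('n)\<close> periods for the growth of the two sets of nodes, and \<open>D + 1\<close> steps for a bound on the
  current values of \<open>Y\<close> to become one on the whole relevant history of \<open>X\<close>.\<close>

definition cycle :: nat where "cycle = CARD('n) * K + D + 1"

definition loss :: real where "loss = \<alpha> ^ cycle / 2"

lemma loss: "0 < loss" "loss < 1"
proof -
  have "\<alpha> ^ cycle \<le> 1" using \<alpha> by (simp add: power_le_one)
  then show "0 < loss" "loss < 1" unfolding loss_def using \<alpha> by auto
qed

lemma Y_fills_history:
  assumes "trajectory X Y" "nonneg_at X Y k" "0 \<le> \<epsilon>"
    and ge: "\<And>i. \<epsilon> \<le> Y i k"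
  shows "nonneg_at (\<lambda>i s. X i s - \<alpha> ^ (D + 1) * \<epsilon>) (\<lambda>i s. Y i s - \<alpha> ^ (D + 1) * \<epsilon>) (k + D + 1)"
proof -
  have "\<alpha> ^ (D + 1) * \<epsilon> \<le> X i s"
    if "int (k + D + 1) - int D \<le> s" "s \<le> int (k + D + 1)" for i s
  proof -
    have "\<alpha> ^ (D + 1) * \<epsilon> \<le> \<alpha> ^ nat (s - int k) * \<epsilon>"
      using \<alpha> that assms(3) by (intro mult_right_mono power_decreasing) auto
    also have "\<dots> \<le> X i s"
      using that by (intro Y_spreads_to_X[OF assms(1,2) ge assms(3)]) simp
    finally show ?thesis .
  qed
  moreover have "\<alpha> ^ (D + 1) * \<epsilon> \<le> Y i (k + D + 1)" for i
    using Y_persists[OF assms(1,2) ge[of i] assms(3), of "D + 1"] by (simp add: add.assoc)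
  ultimately show ?thesis
    unfolding nonneg_at_def by auto
qed

text \<open>A node whose \<open>Y\<close> lies in the lower half of the interval keeps a distance from the upper end and
  passes a smaller one on along edges; likewise for the upper half. So
  \<open>one_of_two_spreading_sets_fills\<close> applies to the two gaps \<open>Y - l\<close> and \<open>h - Y\<close>, and the end that all
  nodes avoid can be moved inwards.\<close>

lemma confined_contracts:
  assumes traj: "trajectory X Y" and conf: "confined X Y k l h" and "l \<le> h"
  shows "\<exists>l' h'. l \<le> l' \<and> l' \<le> h' \<and> h' \<le> h \<and> h' - l' = (1 - loss) * (h - l) \<and>
      confined X Y (k + cycle) l' h'"
proof -
  define w where "w = (h - l) / 2"
  have w: "0 \<le> w" using \<open>l \<le> h\<close> by (simp add: w_def)
  let ?lo = "\<lambda>i s. Y i s - l" and ?up = "\<lambda>i s. h - Y i s"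
  let ?Xlo = "\<lambda>i s. X i s - l" and ?Xup = "\<lambda>i s. h - X i s"
  \<comment> \<open>\<open>A Z m\<close> consists of the nodes whose gap \<open>Z\<close> is still large after \<open>m\<close> periods.\<close>
  define A where "A Z m = {i. \<alpha> ^ (m * K) * w \<le> Z i (k + m * K)}"
    for Z :: "'n \<Rightarrow> nat \<Rightarrow> real" and m
  let ?E = "\<lambda>m. \<Union>s\<in>{k + m * K + D + 1..<k + m * K + K}. G s"
  have mono: "A Z m \<subseteq> A Z (Suc m)"
    and spread: "(j, i) \<in> ?E m \<Longrightarrow> j \<in> A Z m \<Longrightarrow> i \<in> A Z (Suc m)"
    if Z: "trajectory W Z" "nonneg_at W Z k" for W Z m i j
  proof -
    have nn: "nonneg_at W Z (k + m * K)"
      using nonneg_at_mono[OF Z] by simp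
    have pos: "0 \<le> \<alpha> ^ (m * K) * w" using \<alpha> w by simp
    have idx: "k + Suc m * K = (k + m * K) + K"
      by simp
    have pow: "\<alpha> ^ (Suc m * K) * w = \<alpha> ^ K * (\<alpha> ^ (m * K) * w)"
      by (simp add: power_add)
    show "A Z m \<subseteq> A Z (Suc m)"
      unfolding A_def idx pow using Y_persists[OF Z(1) nn _ pos, of _ K] by blast
    show "i \<in> A Z (Suc m)" if E: "(j, i) \<in> ?E m" "j \<in> A Z m"
    proof -
      obtain s where "(j, i) \<in> G s" "k + m * K + D < s" "s < k + m * K + K"
        using E(1) by auto
      from Y_spreads_along_edge[OF Z(1) nn _ pos this] E(2)
      show ?thesis unfolding A_def idx pow by simp
    qed
  qed
  note traj' = trajectory_gaps[OF traj]
  have nn: "nonneg_at ?Xlo ?lo k" "nonneg_at ?Xup ?up k"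
    using conf unfolding confined_def by auto
  have full: "A ?lo CARD('n) = UNIV \<or> A ?up CARD('n) = UNIV"
  proof (rule one_of_two_spreading_sets_fills)
    show "A ?lo 0 \<union> A ?up 0 = UNIV"
      unfolding A_def w_def by (auto simp: field_simps)
    show "has_spanning_tree (?E m)" for m by (rule tree)
  qed (use mono[OF traj'(1) nn(1)] mono[OF traj'(2) nn(2)]
      spread[OF traj'(1) nn(1)] spread[OF traj'(2) nn(2)] in blast)+
  have gain: "nonneg_at (\<lambda>i s. W i s - loss * (h - l)) (\<lambda>i s. Z i s - loss * (h - l)) (k + cycle)"
    if Z: "trajectory W Z" "nonneg_at W Z k" "A Z CARD('n) = UNIV" for W Z
  proof -
    let ?m = "CARD('n) * K"
    have "\<alpha> ^ (D + 1) * (\<alpha> ^ ?m * w) = loss * (h - l)"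
      unfolding loss_def cycle_def w_def by (simp add: power_add)
    moreover have "k + cycle = k + ?m + D + 1"
      unfolding cycle_def by simp
    moreover have "nonneg_at W Z (k + ?m)"
      using nonneg_at_mono[OF Z(1,2)] by simp
    moreover have "\<alpha> ^ ?m * w \<le> Z i (k + ?m)" for i
      using Z(3) unfolding A_def by auto
    ultimately show ?thesis
      using Y_fills_history[of W Z "k + ?m" "\<alpha> ^ ?m * w"] Z(1) \<alpha>(1) w
      by (metis mult_nonneg_nonneg less_imp_le zero_less_power)
  qed
  have conf': "confined X Y (k + cycle) l h"
    using confined_mono[OF traj conf] by simp
  have small: "0 \<le> loss * (h - l)" "loss * (h - l) \<le> h - l"
    using loss \<open>l \<le> h\<close> by (auto intro: mult_left_le_one_le)
  from full show ?thesis
  proof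
    assume "A ?lo CARD('n) = UNIV"
    from gain[OF traj'(1) nn(1) this]
    have "confined X Y (k + cycle) (l + loss * (h - l)) h"
      using conf' unfolding confined_def by (simp add: algebra_simps)
    then show ?thesis
      using small by (intro exI[of _ "l + loss * (h - l)"] exI[of _ h]) (auto simp: algebra_simps)
  next
    assume "A ?up CARD('n) = UNIV"
    from gain[OF traj'(2) nn(2) this]
    have "confined X Y (k + cycle) l (h - loss * (h - l))"
      using conf' unfolding confined_def by (simp add: algebra_simps)
    then show ?thesis
      using small by (intro exI[of _ l] exI[of _ "h - loss * (h - l)"]) (auto simp: algebra_simps)
  qed
qed

definition rate :: real where "rate = root cycle (1 - loss)"

lemma rate: "0 < rate" "rate < 1"
  unfolding rate_def using loss by (auto simp: cycle_def)

lemma contraction_power_le: "(1 - loss) ^ (k div cycle) \<le> rate ^ k / (1 - loss)"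
proof -
  have rate_cycle: "rate ^ cycle = 1 - loss"
    unfolding rate_def using loss by (intro real_root_pow_pos2) (auto simp: cycle_def)
  have "(1 - loss) ^ (k div cycle) * (1 - loss) = rate ^ (cycle * (k div cycle) + cycle)"
    by (simp add: power_add power_mult rate_cycle)
  also have "\<dots> \<le> rate ^ k"
  proof (rule power_decreasing)
    have "k mod cycle < cycle" by (simp add: cycle_def)
    then show "k \<le> cycle * (k div cycle) + cycle"
      using mult_div_mod_eq[of cycle k] by linarith
  qed (use rate in auto)
  finally show ?thesis
    using loss by (simp add: field_simps)
qed

theorem exponential_consensus:
  assumes traj: "trajectory X Y"
  shows "\<exists>z C. \<forall>i k. \<bar>X i (int k) - z\<bar> \<le> C * rate ^ k \<and> \<bar>Y i k - z\<bar> \<le> C * rate ^ k"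
proof -
  obtain R where R: "confined X Y 0 (- R) R"
    by (rule confined_initially)
  have "0 \<le> R"
    using confinedD(1,2)[OF R, of undefined] by linarith
  obtain I where I0: "I 0 = (- R, R)" and I: "\<And>m. fst (I m) \<le> snd (I m) \<and>
      confined X Y (m * cycle) (fst (I m)) (snd (I m))"
    and step: "\<And>m. fst (I m) \<le> fst (I (Suc m)) \<and> snd (I (Suc m)) \<le> snd (I m) \<and>
      snd (I (Suc m)) - fst (I (Suc m)) = (1 - loss) * (snd (I m) - fst (I m))"
  proof -
    let ?P = "\<lambda>m J. fst J \<le> snd J \<and> confined X Y (m * cycle) (fst J) (snd J) \<and>
      (m = 0 \<longrightarrow> J = (- R, R))"
    let ?Q = "\<lambda>(m::nat) J J'. fst J \<le> fst J' \<and> snd J' \<le> snd J \<and>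
      snd J' - fst J' = (1 - loss) * (snd J - fst J)"
    have "\<exists>I. \<forall>m. ?P m (I m) \<and> ?Q m (I m) (I (Suc m))"
    proof (rule dependent_nat_choice)
      show "\<exists>J. ?P 0 J" using R \<open>0 \<le> R\<close> by auto
      show "\<exists>J'. ?P (Suc m) J' \<and> ?Q m J J'" if "?P m J" for J m
      proof -
        obtain l' h' where "fst J \<le> l'" "l' \<le> h'" "h' \<le> snd J"
          "h' - l' = (1 - loss) * (snd J - fst J)" "confined X Y (m * cycle + cycle) l' h'"
          using confined_contracts[OF traj, of "m * cycle" "fst J" "snd J"] \<open>?P m J\<close> by blast
        then show ?thesis
          by (intro exI[of _ "(l', h')"]) (simp add: add.commute)
      qed
    qed
    then show thesis using that by blast
  qed
  have width: "snd (I m) - fst (I m) = (1 - loss) ^ m * (2 * R)" for m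
    by (induction m) (use I0 step in \<open>auto simp: mult.assoc\<close>)
  have lo: "fst (I m) \<le> fst (I m')" and up: "snd (I m') \<le> snd (I m)" if "m \<le> m'" for m m'
    using lift_Suc_mono_le[of "\<lambda>m. fst (I m)"] lift_Suc_antimono_le[of "\<lambda>m. snd (I m)"] step that
    by auto
  have cross: "fst (I m) \<le> snd (I m')" for m m'
    using lo[of m "max m m'"] up[of m' "max m m'"] I[of "max m m'"] by simp
  define z where "z = (SUP m. fst (I m))"
  have z: "fst (I m) \<le> z" "z \<le> snd (I m)" for m
    unfolding z_def using cross
    by (auto intro!: cSUP_upper cSUP_least bdd_aboveI[of _ "snd (I 0)"])
  let ?C = "2 * R / (1 - loss)"
  have "\<bar>X i (int k) - z\<bar> \<le> ?C * rate ^ k \<and> \<bar>Y i k - z\<bar> \<le> ?C * rate ^ k" for i k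
  proof -
    let ?m = "k div cycle"
    have "confined X Y k (fst (I ?m)) (snd (I ?m))"
      using confined_mono[OF traj, of "?m * cycle"] I by simp
    note conf = confinedD[OF this]
    have "fst (I ?m) \<le> X i (int k)" "X i (int k) \<le> snd (I ?m)"
      "fst (I ?m) \<le> Y i k" "Y i k \<le> snd (I ?m)"
      using conf(1,2)[of i] conf(3)[of "int k" i] by auto
    then have "\<bar>X i (int k) - z\<bar> \<le> snd (I ?m) - fst (I ?m)"
      "\<bar>Y i k - z\<bar> \<le> snd (I ?m) - fst (I ?m)"
      using z[of ?m] by linarith+
    moreover have "snd (I ?m) - fst (I ?m) \<le> ?C * rate ^ k"
      using mult_left_mono[OF contraction_power_le[of k], of "2 * R"] \<open>0 \<le> R\<close>
      unfolding width by (simp add: mult.commute)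
    ultimately show ?thesis by linarith
  qed
  then show ?thesis by blast
qed

end


section \<open>Velocity feedback as averaging\<close>

text \<open>\<open>S\<close> is a diagonal entry of the Laplacian, \<open>p\<close> and \<open>p'\<close> are consecutive gains. By \<open>p \<le> b\<close>, \<open>e \<le> 1\<close>
  and \<open>4 * S \<le> p\<^sup>2\<close> the weight is at least \<open>(1 - p / p') * (1 - p * T / 2)\<close>; that the gains do not
  decrease makes this nonnegative.\<close>

lemma position_weight_nonneg:
  fixes T p p' b e S :: real
  assumes "0 < T" "0 < p" "p \<le> b" "b \<le> p'" "p' * T < 1" "0 \<le> e" "e \<le> 1"
    and "0 \<le> S" "4 * S \<le> p\<^sup>2"
  shows "0 \<le> 1 - (p * T / 2 + p / p' * (1 - b * T)) - 2 * e * T / p' * S"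
proof -
  have p': "0 < p'" "p \<le> p'" using assms by auto
  have "p * T \<le> p' * T"
    using p' \<open>0 < T\<close> by (intro mult_right_mono) auto
  then have "0 \<le> (p' - p) * (1 - p * T / 2)"
    using assms(5) p' by (intro mult_nonneg_nonneg) auto
  also have "\<dots> = p' - p' * p * T / 2 - p * (1 - p * T) - T * (p\<^sup>2 / 2)"
    by (simp add: field_simps power2_eq_square)
  also have "\<dots> \<le> p' - p' * p * T / 2 - p * (1 - b * T) - 2 * T * S"
  proof -
    have "p * (p * T) \<le> p * (b * T)"
      using assms by (intro mult_left_mono mult_right_mono) auto
    moreover have "T * (4 * S) \<le> T * p\<^sup>2"
      using assms by (intro mult_left_mono) auto
    ultimately show ?thesis by (simp add: algebra_simps)
  qed
  also have "\<dots> \<le> p' - p' * p * T / 2 - p * (1 - b * T) - 2 * e * T * S"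
  proof -
    have "e * (T * S) \<le> 1 * (T * S)"
      using assms by (intro mult_right_mono) auto
    then show ?thesis by (simp add: algebra_simps)
  qed
  also have "\<dots> = p' * (1 - (p * T / 2 + p / p' * (1 - b * T)) - 2 * e * T / p' * S)"
    using p' by (simp add: field_simps)
  finally show ?thesis
    using p' by (simp add: zero_le_mult_iff)
qed

text \<open>The auxiliary quantity \<open>y = x + (2 / p) v\<close> is updated by a weighted mean of \<open>y\<close>, \<open>x\<close> and the
  received positions \<open>z j\<close>. The contraction factor \<open>e\<close> of the constraint operator is absorbed by
  \<open>b\<close>, the gain for which \<open>e (1 - p T) = 1 - b T\<close>.\<close>

lemma feedback_step_as_average:
  fixes T p p' b e x v :: real and \<alpha> z :: "'n::finite \<Rightarrow> real"
  assumes "p \<noteq> 0" "p' \<noteq> 0" "e * (1 - p * T) = 1 - b * T"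
  defines "c \<equiv> p * T / 2 + p / p' * (1 - b * T)"
  shows "x + T * v + 2 / p' * (e * (v - p * T * v + (\<Sum>j\<in>UNIV. \<alpha> j * T * (z j - x)))) =
    c * (x + 2 / p * v) + (1 - c - (\<Sum>j\<in>UNIV. 2 * e * T / p' * \<alpha> j)) * x
    + (\<Sum>j\<in>UNIV. 2 * e * T / p' * \<alpha> j * z j)"
proof -
  define S Z where "S = (\<Sum>j\<in>UNIV. \<alpha> j)" and "Z = (\<Sum>j\<in>UNIV. \<alpha> j * z j)"
  define q u where "q = 2 / p'" and "u = (1 - b * T) * v"
  have q: "2 * e * T / p' = q * e * T"
    by (simp add: q_def)
  have received: "(\<Sum>j\<in>UNIV. \<alpha> j * T * (z j - x)) = T * Z - T * x * S"
    by (simp add: S_def Z_def sum_distrib_left sum_subtractf algebra_simps)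
  have weights: "(\<Sum>j\<in>UNIV. 2 * e * T / p' * \<alpha> j) = q * e * T * S"
    "(\<Sum>j\<in>UNIV. 2 * e * T / p' * \<alpha> j * z j) = q * e * T * Z"
    unfolding q by (simp_all only: S_def Z_def sum_distrib_left mult.assoc)
  have "e * (v - p * T * v) = u"
    unfolding u_def assms(3)[symmetric] by (simp add: algebra_simps)
  then have velocity: "e * (v - p * T * v + (T * Z - T * x * S)) = u + e * (T * Z - T * x * S)"
    by (simp only: distrib_left)
  have mean: "c * (x + 2 / p * v) = c * x + (T * v + q * u)"
    using assms(1,2) unfolding c_def q_def u_def by (simp add: field_simps)
  show ?thesis
    unfolding received weights velocity mean q_def[symmetric] by (simp add: algebra_simps)
qed

text \<open>Turns the given division of time into the windows of constant length, one beginning at every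
  time, that \<open>delayed_consensus\<close> works with.\<close>

lemma recurring_interval:
  fixes t :: "nat \<Rightarrow> nat"
  assumes "t 0 = 0" "\<And>m. t m < t (Suc m) \<and> t (Suc m) - t m \<le> \<eta>" "0 < q"
  shows "\<exists>m. q \<le> t m \<and> t (Suc m) \<le> q + 2 * \<eta>"
proof -
  have "m \<le> t m" for m
    by (induction m) (use assms(2) in \<open>auto intro: Suc_leI le_less_trans\<close>)
  then have ex: "\<exists>m. q \<le> t m" by blast
  define m where "m = (LEAST m. q \<le> t m)"
  have m: "q \<le> t m" unfolding m_def using ex by (rule LeastI_ex)
  then obtain m' where m': "m = Suc m'"
    using assms(1,3) by (cases m) auto
  then have "t m' < q"
    using not_less_Least[of m' "\<lambda>m. q \<le> t m"] unfolding m_def by simp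
  then have "t (Suc m) \<le> q + 2 * \<eta>"
    using assms(2)[of m] assms(2)[of m'] unfolding m' by linarith
  then show ?thesis using m by blast
qed

lemma uniform_positive_lower_bound:
  fixes F :: "'n::finite \<Rightarrow> real"
  assumes "\<And>i. 0 < F i"
  obtains \<alpha> where "0 < \<alpha>" "\<And>i. \<alpha> \<le> F i"
proof
  show "0 < Min (range F)" using assms by simp
  show "Min (range F) \<le> F i" for i by simp
qed


section \<open>Consensus\<close>

theorem theorem1:
  fixes x v :: "'n::finite \<Rightarrow> int \<Rightarrow> real ^ 'r"
    and u \<pi> :: "'n \<Rightarrow> nat \<Rightarrow> real ^ 'r"
    and p e b :: "'n \<Rightarrow> nat \<Rightarrow> real"
    and G :: "nat \<Rightarrow> ('n \<times> 'n) set"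
    and a :: "nat \<Rightarrow> 'n \<Rightarrow> 'n \<Rightarrow> real"
    and \<tau> :: "nat \<Rightarrow> 'n \<Rightarrow> 'n \<Rightarrow> nat"
    and V :: "'n \<Rightarrow> (real ^ 'r) set"
    and \<rho>_max \<rho>_inf :: "'n \<Rightarrow> real"
    and T \<mu>\<^sub>c M :: real
  assumes T_pos: "T > 0"
    and weight_edge: "\<And>k i j. (j, i) \<in> G k \<Longrightarrow> a k i j > 0"
    and weight_non_edge: "\<And>k i j. (j, i) \<notin> G k \<Longrightarrow> a k i j = 0"
    and mu_pos: "\<mu>\<^sub>c > 0"
    and weight_lower: "\<And>k i j. a k i j > 0 \<Longrightarrow> a k i j \<ge> \<mu>\<^sub>c"
    and M_pos: "M > 0"
    and delay_bound: "\<And>k i j. real (\<tau> k i j) \<le> M"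
    and gain_pos: "\<And>i k. p i k > 0"
    and e_eq: "\<And>i k. e i k =
        constraint_ratio (V i) (v i (int k) - (p i k * T) *\<^sub>R v i (int k) + \<pi> i k)"
    and b_eq: "\<And>i k. b i k = (1 - e i k * (1 - p i k * T)) / T"
    and init_x: "\<And>i k. k < 0 \<Longrightarrow> x i (k + 1) = x i k + T *\<^sub>R v i k"
    and init_v: "\<And>i k. k \<le> 0 \<Longrightarrow> v i k \<in> V i"
    and init_v0: "\<And>i. v i 0 = constraint_op (V i) (v i 0)"
    and dyn_x: "\<And>i k. x i (int k + 1) = x i (int k) + T *\<^sub>R v i (int k)"
    and dyn_v: "\<And>i k. v i (int k + 1) = u i k"
    and input_u: "\<And>i k. u i k =
        constraint_op (V i) (v i (int k) - (p i k * T) *\<^sub>R v i (int k) + \<pi> i k)"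
    and input_pi: "\<And>i k. \<pi> i k =
        (\<Sum>j\<in>in_neighbors (G k) i.
           (a k i j * T) *\<^sub>R (x j (int k - int (\<tau> k i j)) - x i (int k)))"
    and V_sets: "\<And>i. V i \<noteq> {} \<and> bounded (V i) \<and> closed (V i) \<and> 0 \<in> V i"
    and V_max: "\<And>i. (\<exists>y\<in>V i. norm (constraint_op (V i) y) = \<rho>_max i) \<and>
                     (\<forall>y\<in>V i. norm (constraint_op (V i) y) \<le> \<rho>_max i) \<and> \<rho>_max i > 0"
    and V_inf: "\<And>i. (INF y\<in>- V i. norm (constraint_op (V i) y)) = \<rho>_inf i \<and> \<rho>_inf i > 0"
    and gain_step: "\<And>i k. 1 / T > p i (Suc k) \<and> p i (Suc k) \<ge> b i k \<and> b i k > 0"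
    and gain_laplacian:
      "\<And>i. \<exists>d>0. \<forall>k. (p i k)\<^sup>2 > 4 * d \<and> 4 * d \<ge> 4 * laplacian (a k) $ i $ i"
    and joint_spanning_tree:
      "\<exists>(t :: nat \<Rightarrow> nat) (\<eta> :: nat). \<eta> > 0 \<and> t 0 = 0 \<and>
         (\<forall>m. t m < t (Suc m) \<and> t (Suc m) - t m \<le> \<eta> \<and>
              has_spanning_tree (\<Union>k\<in>{t m..<t (Suc m)}. G k))"
  shows "(\<exists>xbar C \<mu>. C > 0 \<and> 0 < \<mu> \<and> \<mu> \<le> 1 \<and>
            (\<forall>i (k::nat). norm (x i (int k) - xbar) \<le> C * (1 - \<mu>) ^ k)) \<and>
         (\<forall>i. (\<lambda>k::nat. v i (int k)) \<longlonglongrightarrow> 0) \<and>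
         (\<forall>i (k::int). v i k \<in> V i)"
proof -
  have V: "closed (V i)" "0 \<in> V i" "bounded (V i)" for i
    using V_sets by auto
  define w where "w i k = v i (int k) - (p i k * T) *\<^sub>R v i (int k) + \<pi> i k" for i k
  have v_Suc: "v i (int k + 1) = constraint_op (V i) (w i k)" for i k
    using dyn_v input_u unfolding w_def by simp
  have velocity_mem: "v i s \<in> V i" for i s
  proof (cases "s \<le> 0")
    case False
    then have "s = int (nat (s - 1)) + 1" by simp
    then show ?thesis
      using v_Suc[of i "nat (s - 1)"] constraint_op_mem[OF V(1,2)] by metis
  qed (rule init_v)

  have e_scales: "v i (int k + 1) = e i k *\<^sub>R w i k" and e01: "0 \<le> e i k" "e i k \<le> 1" for i k
    using constraint_op_scales[OF V(1,2), of i "w i k"] v_Suc e_eq unfolding w_def by simp_all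
  have eb: "e i k * (1 - p i k * T) = 1 - b i k * T" for i k
    unfolding b_eq using T_pos by simp
  have p_Suc: "p i (Suc k) * T < 1" "b i k \<le> p i (Suc k)" for i k
    using gain_step[of i k] T_pos by (auto simp: field_simps)
  \<comment> \<open>The bound \<open>p < 1 / T\<close> is assumed from time one on; at time zero it follows from
    \<open>e (1 - p T) = 1 - b T > 0\<close>.\<close>
  have bT: "b i k * T < 1" for i k
    using p_Suc[of i k] T_pos by (smt (verit) mult_right_mono)
  then have factors: "0 < e i k * (1 - p i k * T)" for i k
    using eb[of i k] by simp
  have pT: "p i k * T < 1" for i k
    using factors[of i k] e01(1)[of i k] by (auto simp: zero_less_mult_iff)
  have pb: "p i k \<le> b i k" for i k
  proof -
    have "e i k * (1 - p i k * T) \<le> 1 * (1 - p i k * T)"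
      using pT[of i k] e01[of i k] by (intro mult_right_mono) auto
    then have "p i k * T \<le> b i k * T" using eb[of i k] by simp
    then show ?thesis using T_pos by simp
  qed
  have p_mono: "p i 0 \<le> p i k" for i k
    by (rule lift_Suc_mono_le[of "p i"]) (use order_trans[OF pb p_Suc(2)] in auto)

  have a_nonneg: "0 \<le> a k i j" for k i j
    using weight_edge weight_non_edge by (cases "(j, i) \<in> G k") (auto intro: less_imp_le)
  define S where "S k i = (\<Sum>j\<in>UNIV. a k i j)" for k i
  have "\<exists>d>0. \<forall>k. 4 * d < (p i k)\<^sup>2 \<and> S k i \<le> d" for i
    using gain_laplacian[of i] unfolding laplacian_def S_def by auto
  then obtain d where d: "\<And>i. 0 < d i" "\<And>i k. 4 * d i < (p i k)\<^sup>2" "\<And>i k. S k i \<le> d i"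
    by metis
  have S_bounds: "0 \<le> S k i" "4 * S k i \<le> (p i k)\<^sup>2" for k i
    using a_nonneg d(2)[of i k] d(3)[of k i] unfolding S_def by (auto intro: sum_nonneg)
  have \<pi>: "\<pi> i k = (\<Sum>j\<in>UNIV. (a k i j * T) *\<^sub>R (x j (int k - int (\<tau> k i j)) - x i (int k)))"
    for i k
    unfolding input_pi in_neighbors_def
    by (intro sum.mono_neutral_left) (auto simp: weight_non_edge)

  define D where "D = nat \<lfloor>M\<rfloor>"
  have \<tau>: "\<tau> k i j \<le> D" for k i j
    unfolding D_def using delay_bound by (simp add: le_nat_floor)
  define \<theta> where "\<theta> k i = p i k * T / 2" for k i
  define c where "c k i = p i k * T / 2 + p i k / p i (Suc k) * (1 - b i k * T)" for k i
  define g where "g k i j = 2 * e i k * T / p i (Suc k) * a k i j" for k i j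
  define f where "f k i = 1 - c k i - (\<Sum>j\<in>UNIV. g k i j)" for k i
  define y where "y i k = x i (int k) + (2 / p i k) *\<^sub>R v i (int k)" for i k
  have c_ge: "\<theta> k i \<le> c k i" for k i
    using gain_pos bT[of i k] unfolding c_def \<theta>_def by (simp add: less_imp_le)
  have \<theta>_pos: "0 < \<theta> k i" for k i
    using gain_pos T_pos unfolding \<theta>_def by simp
  interpret delayed_averaging \<theta> c f g \<tau> D
  proof
    fix k i j
    show "0 \<le> \<theta> k i" "\<theta> k i \<le> 1" "0 \<le> c k i"
      using \<theta>_pos[of k i] pT[of i k] c_ge[of k i] unfolding \<theta>_def by auto
    show "0 \<le> g k i j"
      unfolding g_def using e01 gain_pos[of i "Suc k"] T_pos a_nonneg
      by (intro mult_nonneg_nonneg divide_nonneg_pos) auto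
    show "0 \<le> f k i"
      using position_weight_nonneg[OF T_pos gain_pos[of i k] pb p_Suc(2) p_Suc(1) e01 S_bounds]
      unfolding f_def c_def g_def S_def sum_distrib_left .
    show "c k i + f k i + (\<Sum>j\<in>UNIV. g k i j) = 1" by (simp add: f_def)
    show "\<tau> k i j \<le> D" by (rule \<tau>)
  qed

  have traj: "trajectory (\<lambda>i s. x i s $ r) (\<lambda>i k. y i k $ r)" for r
    unfolding trajectory_def
  proof (intro allI conjI)
    fix i k
    have p0: "p i k \<noteq> 0" "p i (Suc k) \<noteq> 0"
      using gain_pos[of i k] gain_pos[of i "Suc k"] by auto
    have v: "v i (int k) $ r = p i k / 2 * (y i k $ r - x i (int k) $ r)"
      unfolding y_def using p0 by simp
    show "x i (int k + 1) $ r = (1 - \<theta> k i) * x i (int k) $ r + \<theta> k i * y i k $ r"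
      unfolding dyn_x by (simp add: v \<theta>_def algebra_simps)
    have "y i (Suc k) $ r = x i (int k + 1) $ r + 2 / p i (Suc k) * v i (int k + 1) $ r"
      unfolding y_def by (simp add: add.commute)
    also have "\<dots> = x i (int k) $ r + T * v i (int k) $ r + 2 / p i (Suc k) * (e i k *
        (v i (int k) $ r - p i k * T * v i (int k) $ r
         + (\<Sum>j\<in>UNIV. a k i j * T * (x j (int k - int (\<tau> k i j)) $ r - x i (int k) $ r))))"
      unfolding e_scales dyn_x w_def \<pi> by simp
    also have "\<dots> = c k i * y i k $ r + f k i * x i (int k) $ r
       + (\<Sum>j\<in>UNIV. g k i j * x j (int k - int (\<tau> k i j)) $ r)"
      unfolding feedback_step_as_average[OF p0 eb] f_def c_def g_def y_def by simp
    finally show "y i (Suc k) $ r = c k i * y i k $ r + f k i * x i (int k) $ r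
       + (\<Sum>j\<in>UNIV. g k i j * x j (int k - int (\<tau> k i j)) $ r)" .
  qed

  \<comment> \<open>Bounded positions bound the argument \<open>w\<close> of the constraint operator, hence its ratio \<open>e\<close> from
    below. It is this bound that keeps the weights of the edges away from zero.\<close>
  have "\<forall>r. \<exists>R. \<forall>i s. - int D \<le> s \<longrightarrow> \<bar>x i s $ r\<bar> \<le> R"
    using trajectory_bounded[OF traj] by metis
  then obtain R0 where R0: "\<And>r i s. - int D \<le> s \<Longrightarrow> \<bar>x i s $ r\<bar> \<le> R0 r"
    by metis
  define R where "R = sum R0 UNIV"
  have x_bound: "norm (x i s) \<le> R" if "- int D \<le> s" for i s
    unfolding R_def using norm_le_l1_cart[of "x i s"] R0[OF that]
    by (meson order_trans sum_mono)
  have "\<forall>i. \<exists>B. \<forall>z\<in>V i. norm z \<le> B"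
    using V(3) unfolding bounded_iff by blast
  then obtain B where B: "\<And>i z. z \<in> V i \<Longrightarrow> norm z \<le> B i"
    by metis
  define W where "W i = B i + d i * (T * (2 * R)) + 1" for i
  have w_bound: "norm (w i k) \<le> W i" and W_pos: "0 < W i" for i k
  proof -
    have "0 \<le> R"
      using order_trans[OF norm_ge_zero x_bound[of 0 i]] by simp
    have "norm ((a k i j * T) *\<^sub>R (x j (int k - int (\<tau> k i j)) - x i (int k)))
        \<le> a k i j * (T * (2 * R))" for j
    proof -
      have "norm (x j (int k - int (\<tau> k i j)) - x i (int k)) \<le> R + R"
        using \<tau>[of k i j] by (intro norm_triangle_le_diff add_mono x_bound) auto
      then have "a k i j * T * norm (x j (int k - int (\<tau> k i j)) - x i (int k))
          \<le> a k i j * T * (2 * R)"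
        using a_nonneg T_pos by (intro mult_left_mono) auto
      then show ?thesis
        using a_nonneg[of k i j] T_pos by (simp add: mult.assoc)
    qed
    then have "norm (\<pi> i k) \<le> (\<Sum>j\<in>UNIV. a k i j * (T * (2 * R)))"
      unfolding \<pi> by (intro sum_norm_le) auto
    also have "\<dots> = S k i * (T * (2 * R))"
      unfolding S_def by (simp add: sum_distrib_right)
    also have "\<dots> \<le> d i * (T * (2 * R))"
      using d(3) T_pos \<open>0 \<le> R\<close> by (intro mult_right_mono) auto
    finally have "norm (\<pi> i k) \<le> d i * (T * (2 * R))" .
    moreover have "norm (v i (int k) - (p i k * T) *\<^sub>R v i (int k)) \<le> B i"
    proof -
      have "v i (int k) - (p i k * T) *\<^sub>R v i (int k) = (1 - p i k * T) *\<^sub>R v i (int k)"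
        by (simp add: algebra_simps)
      also have "norm \<dots> \<le> 1 * norm (v i (int k))"
        unfolding norm_scaleR using pT[of i k] gain_pos[of i k] T_pos
        by (intro mult_right_mono) auto
      also have "\<dots> \<le> B i"
        using B[OF velocity_mem] by simp
      finally show ?thesis .
    qed
    ultimately show "norm (w i k) \<le> W i"
      unfolding w_def W_def by (smt (verit) norm_triangle_ineq)
    show "0 < W i"
      using order_trans[OF norm_ge_zero B[OF V(2)], of i] d(1)[of i] T_pos \<open>0 \<le> R\<close>
      unfolding W_def by (intro add_nonneg_pos add_nonneg_nonneg mult_nonneg_nonneg) auto
  qed
  define e_low where "e_low i = min 1 (\<rho>_inf i / W i)" for i
  have \<rho>: "0 < \<rho>_inf i" "z \<notin> V i \<Longrightarrow> \<rho>_inf i \<le> norm (constraint_op (V i) z)" for i z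
  proof -
    show "0 < \<rho>_inf i" using V_inf by auto
    show "\<rho>_inf i \<le> norm (constraint_op (V i) z)" if "z \<notin> V i"
    proof -
      have "(INF y\<in>- V i. norm (constraint_op (V i) y)) \<le> norm (constraint_op (V i) z)"
        using that by (intro cINF_lower bdd_belowI[of _ 0]) auto
      then show ?thesis using V_inf[of i] by simp
    qed
  qed
  have e_low_pos: "0 < e_low i" for i
    unfolding e_low_def using \<rho>(1) W_pos by simp
  have e_ge: "e_low i \<le> e i k" for i k
    unfolding e_low_def e_eq w_def[symmetric]
    by (rule constraint_ratio_ge[OF V(1,2) \<rho>(2) less_imp_le[OF \<rho>(1)] w_bound W_pos])

  define \<gamma> where "\<gamma> i = min (p i 0 * T / 2) (2 * e_low i * T * T * \<mu>\<^sub>c)" for i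
  have "0 < \<gamma> i" for i
    unfolding \<gamma>_def using gain_pos T_pos e_low_pos mu_pos by simp
  then obtain \<alpha> where \<alpha>: "0 < \<alpha>" "\<And>i. \<alpha> \<le> \<gamma> i"
    using uniform_positive_lower_bound[of \<gamma>] by blast
  have \<theta>_ge: "\<alpha> \<le> \<theta> k i" for k i
  proof -
    have "\<alpha> \<le> p i 0 * T / 2" using \<alpha>(2)[of i] unfolding \<gamma>_def by simp
    also have "\<dots> \<le> \<theta> k i" unfolding \<theta>_def using p_mono T_pos by simp
    finally show ?thesis .
  qed
  have g_ge: "\<alpha> \<le> g k i j" if "(j, i) \<in> G k" for k i j
  proof -
    have "T \<le> 1 / p i (Suc k)"
      using p_Suc(1)[of i k] gain_pos[of i "Suc k"] by (simp add: field_simps)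
    moreover have "\<mu>\<^sub>c \<le> a k i j"
      using weight_lower weight_edge that by blast
    ultimately have "2 * e_low i * T * T * \<mu>\<^sub>c \<le> 2 * e i k * T * (1 / p i (Suc k)) * a k i j"
      using e_ge[of i k] e_low_pos[of i] T_pos mu_pos e01[of i k] gain_pos[of i "Suc k"]
      by (intro mult_mono) auto
    then show ?thesis
      using \<alpha>(2)[of i] unfolding \<gamma>_def g_def by simp
  qed

  obtain t :: "nat \<Rightarrow> nat" and \<eta> where t0: "t 0 = 0"
    and t: "\<And>m. t m < t (Suc m) \<and> t (Suc m) - t m \<le> \<eta>"
    and t_tree: "\<And>m. has_spanning_tree (\<Union>k\<in>{t m..<t (Suc m)}. G k)"
    using joint_spanning_tree by blast
  define K where "K = D + 1 + 2 * \<eta>"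
  interpret delayed_consensus \<theta> c f g \<tau> D G \<alpha> K
  proof
    show "0 < \<alpha>" by (rule \<alpha>(1))
    show "\<alpha> \<le> 1" using \<theta>_ge \<theta>(2) by (meson order_trans)
    fix k i j
    show "\<alpha> \<le> \<theta> k i" by (rule \<theta>_ge)
    show "\<alpha> \<le> c k i" using \<theta>_ge c_ge by (rule order_trans)
    show "\<alpha> \<le> g k i j" if "(j, i) \<in> G k" using that by (rule g_ge)
  next
    fix k
    obtain m where "k + D + 1 \<le> t m" "t (Suc m) \<le> k + D + 1 + 2 * \<eta>"
      using recurring_interval[OF t0 t, of "k + D + 1"] by auto
    then have "{t m..<t (Suc m)} \<subseteq> {k + D + 1..<k + K}"
      unfolding K_def by auto
    then show "has_spanning_tree (\<Union>s\<in>{k + D + 1..<k + K}. G s)"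
      using has_spanning_tree_mono[OF t_tree[of m]] by (metis UN_mono subset_refl)
  qed

  have "\<forall>r. \<exists>z C. \<forall>i k. \<bar>x i (int k) $ r - z\<bar> \<le> C * rate ^ k \<and> \<bar>y i k $ r - z\<bar> \<le> C * rate ^ k"
    using exponential_consensus[OF traj] by blast
  then obtain z C where z: "\<And>r i k. \<bar>x i (int k) $ r - z r\<bar> \<le> C r * rate ^ k"
    "\<And>r i k. \<bar>y i k $ r - z r\<bar> \<le> C r * rate ^ k"
    by metis
  define xbar where "xbar = (\<chi> r. z r)"
  define C' where "C' = sum C UNIV"
  have l1: "norm (q - xbar) \<le> C' * rate ^ k"
    if "\<And>r. \<bar>q $ r - z r\<bar> \<le> C r * rate ^ k" for q k
  proof -
    have "norm (q - xbar) \<le> (\<Sum>r\<in>UNIV. \<bar>q $ r - z r\<bar>)"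
      using norm_le_l1_cart[of "q - xbar"] by (simp add: xbar_def)
    also have "\<dots> \<le> (\<Sum>r\<in>UNIV. C r * rate ^ k)"
      using that by (intro sum_mono)
    finally show ?thesis by (simp add: C'_def sum_distrib_right)
  qed
  have x_conv: "norm (x i (int k) - xbar) \<le> C' * rate ^ k"
    and y_conv: "norm (y i k - xbar) \<le> C' * rate ^ k" for i k
    by (intro l1 z)+
  have C'_nonneg: "0 \<le> C'"
    using order_trans[OF norm_ge_zero x_conv[of undefined 0]] by simp

  have "(\<lambda>k. v i (int k)) \<longlonglongrightarrow> 0" for i
  proof (rule Lim_null_comparison)
    show "(\<lambda>k. 1 / T * (C' * rate ^ k)) \<longlonglongrightarrow> 0"
      by (intro tendsto_mult_right_zero LIMSEQ_power_zero) (use rate in auto)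
    have "norm (v i (int k)) \<le> 1 / T * (C' * rate ^ k)" for k
    proof -
      have "v i (int k) = (p i k / 2) *\<^sub>R ((y i k - xbar) - (x i (int k) - xbar))"
        unfolding y_def using gain_pos[of i k] by simp
      also have "norm \<dots> \<le> p i k / 2 * (C' * rate ^ k + C' * rate ^ k)"
        unfolding norm_scaleR using gain_pos[of i k]
        by (intro mult_mono norm_triangle_le_diff add_mono x_conv y_conv) auto
      also have "\<dots> = p i k * (C' * rate ^ k)" by simp
      also have "\<dots> \<le> 1 / T * (C' * rate ^ k)"
        using pT[of i k] T_pos C'_nonneg rate
        by (intro mult_right_mono) (auto simp: field_simps)
      finally show ?thesis .
    qed
    then show "\<forall>\<^sub>F k in sequentially. norm (v i (int k)) \<le> 1 / T * (C' * rate ^ k)"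
      by simp
  qed
  moreover have "norm (x i (int k) - xbar) \<le> (C' + 1) * (1 - (1 - rate)) ^ k" for i k
    using x_conv[of i k] rate by (simp add: distrib_right) (smt (verit) zero_less_power)
  then have "\<exists>xbar C \<mu>. C > 0 \<and> 0 < \<mu> \<and> \<mu> \<le> 1 \<and>
      (\<forall>i (k::nat). norm (x i (int k) - xbar) \<le> C * (1 - \<mu>) ^ k)"
    using C'_nonneg rate
    by (intro exI[of _ xbar] exI[of _ "C' + 1"] exI[of _ "1 - rate"]) auto
  ultimately show ?thesis
    using velocity_mem by blast
qed

end
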